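(* Let $a$ and $b$ be nonnegative real parameters with $a\neq b$. Let $m$ be a positive integer and let $x\in[a,b]$. Let $k$ and $n$ be nonnegative integers with $n\geq k$. Then $$\frac{d}{dx}\mathbb{Y}_{k}^{n}(x;a,b,m)=n\left(\frac{\mathbb{Y}_{k-1}^{n-1}(x;a,b,m-1)-\mathbb{Y}_{k}^{n-1}(x;a,b,m-1)}{b-a}\right).$$
   Context: Here $[a,b]=\{x\in\mathbb{R}: a\le x\le b\}$ (so $a<b$). For an integer $m$ and a nonnegative integer $k$, put $$f_{\mathbb{Y},k}(x,t;a,b,m)=\frac{t^{k}(x-a)^{k}e^{(b-x)t}}{(b-a)^{m}\,k!}\qquad(t\in\mathbb{C}),$$ and define $\mathbb{Y}_{k}^{n}(x;a,b,m)$, $n=0,1,2,\dots$, by $$f_{\mathbb{Y},k}(x,t;a,b,m)=\sum_{n=0}^{\infty}\mathbb{Y}_{k}^{n}(x;a,b,m)\frac{t^{n}}{n!}.$$ Thus $\mathbb{Y}_k^n(x;a,b,m)=0$ when $0\le n<k$; it is a polynomial in $x$, and the derivative is the derivative of this polynomial. Conventions: $\mathbb{Y}_k^n=0$ when $k<0$ or $n<0$; $0^0=1$. *)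

theory Defs
  imports "HOL-Analysis.Analysis"
begin

definition f_Y :: "nat \<Rightarrow> real \<Rightarrow> complex \<Rightarrow> real \<Rightarrow> real \<Rightarrow> int \<Rightarrow> complex" where
  "f_Y k x t a b m =
     t ^ k * of_real ((x - a) ^ k) * exp (of_real (b - x) * t) / (of_real ((b - a) powi m) * fact k)"

text \<open>
  \<open>Y k n x a b m\<close> is the coefficient of \<open>t ^ n / n!\<close> in the everywhere convergent
  expansion of \<open>f_Y k x t a b m\<close>. The upper and lower index are integers, since the value is
  taken to be \<open>0\<close> when one of them is negative. The coefficients exist, are real and are unique:
  see \<open>Y_unique_expansion\<close> below. The variable \<open>x\<close> ranges over all reals, so that the
  derivative at an end point of \<open>[a, b]\<close> is the two-sided derivative of the polynomial.
\<close>

definition Y :: "int \<Rightarrow> int \<Rightarrow> real \<Rightarrow> real \<Rightarrow> real \<Rightarrow> int \<Rightarrow> real" where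
  "Y k n x a b m =
     (if k < 0 \<or> n < 0 then 0
      else (THE c :: nat \<Rightarrow> real. \<forall>t :: complex.
              (\<lambda>j. of_real (c j) * (t ^ j / fact j)) sums f_Y (nat k) x t a b m) (nat n))"

lemma f_Y_expansion:
  "(\<lambda>j. of_real (if j < k then 0
       else fact j * (x - a) ^ k * (b - x) ^ (j - k) / ((b - a) powi m * fact k * fact (j - k)))
     * (t ^ j / fact j)) sums f_Y k x t a b m"
    (is "(\<lambda>j. of_real (?c j) * (t ^ j / fact j)) sums _")
proof -
  let ?C = "t ^ k * of_real ((x - a) ^ k) / (of_real ((b - a) powi m) * fact k) :: complex"
  let ?g = "\<lambda>j. of_real (?c j) * (t ^ j / fact j) :: complex"
  have "(\<lambda>j. (of_real (b - x) * t) ^ j /\<^sub>R fact j) sums exp (of_real (b - x) * t)"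
    by (rule exp_converges)
  then have "(\<lambda>j. ?C * ((of_real (b - x) * t) ^ j /\<^sub>R fact j)) sums (?C * exp (of_real (b - x) * t))"
    by (rule sums_mult)
  moreover have "?C * ((of_real (b - x) * t) ^ j /\<^sub>R fact j) = ?g (j + k)" for j
    by (simp add: scaleR_conv_of_real power_mult_distrib power_add divide_inverse mult_ac
        del: of_real_diff)
  moreover have "?C * exp (of_real (b - x) * t) = f_Y k x t a b m"
    by (simp add: f_Y_def)
  ultimately have "(\<lambda>j. ?g (j + k)) sums f_Y k x t a b m"
    by simp
  moreover have "(\<Sum>j<k. ?g j) = 0"
    by (intro sum.neutral) simp
  ultimately show ?thesis
    using sums_iff_shift'[of ?g k "f_Y k x t a b m"] by simp
qed

lemma Y_unique_expansion:
  "\<exists>!c :: nat \<Rightarrow> real. \<forall>t :: complex. (\<lambda>j. of_real (c j) * (t ^ j / fact j)) sums f_Y k x t a b m"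
proof (rule ex_ex1I)
  show "\<exists>c :: nat \<Rightarrow> real. \<forall>t :: complex. (\<lambda>j. of_real (c j) * (t ^ j / fact j)) sums f_Y k x t a b m"
    by (rule exI, rule allI, rule f_Y_expansion)
next
  fix c d :: "nat \<Rightarrow> real"
  assume c: "\<forall>t :: complex. (\<lambda>j. of_real (c j) * (t ^ j / fact j)) sums f_Y k x t a b m"
    and d: "\<forall>t :: complex. (\<lambda>j. of_real (d j) * (t ^ j / fact j)) sums f_Y k x t a b m"
  let ?e = "\<lambda>j. of_real (c j - d j) / fact j :: complex"
  have sums0: "(\<lambda>j. ?e j * t ^ j) sums 0" for t :: complex
    using sums_diff[OF c[rule_format, of t] d[rule_format, of t]]
    by (simp add: diff_divide_distrib algebra_simps)
  then have "conv_radius ?e = \<infinity>"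
    by (intro conv_radius_inftyI'') (auto simp: sums_iff)
  then have "Abs_fps ?e = 0"
    using sums0 by (intro eval_fps_eqD) (auto simp: fps_conv_radius_def eval_fps_def sums_iff)
  then have "?e j = 0" for j
    by (metis fps_nth_Abs_fps fps_zero_nth)
  then show "c = d" by (simp add: fun_eq_iff)
qed

end

theory Submission
  imports Defs
begin

text \<open>
  Expanding the exponential in the generating function shows that
    \<open>Y k n x a b m = n! / (b - a)^m * (x - a)^k / k! * (b - x)^(n - k) / (n - k)!\<close>,
  that is, up to a constant \<open>Y\<close> is a product of two divided powers \<open>u ^ j / j!\<close> (lemma
  \<open>Y_eq_divided_powers\<close>). Differentiating a divided power just lowers its index by one (lemma
  \<open>has_real_derivative_divided_power\<close>), so the product rule gives the difference of the products
  with index pairs \<open>(k - 1, n - k)\<close> and \<open>(k, n - k - 1)\<close>. These are the products that occur in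
  \<open>Y (k - 1) (n - 1)\<close> and \<open>Y k (n - 1)\<close>, and the constants agree because \<open>n! = n (n - 1)!\<close> and
  \<open>(b - a)^m = (b - a) (b - a)^(m - 1)\<close>.
\<close>

text \<open>
  Integer indices with value \<open>0\<close> at the negative ones make both the derivative rule and the
  product formula for \<open>Y\<close> hold without case distinctions at \<open>k = 0\<close> and \<open>k = n\<close>.
\<close>

definition divided_power :: "int \<Rightarrow> real \<Rightarrow> real" where
  "divided_power j u = (if j < 0 then 0 else u ^ nat j / fact (nat j))"

lemma divided_power_neg [simp]: "j < 0 \<Longrightarrow> divided_power j u = 0"
  by (simp add: divided_power_def)

lemma has_real_derivative_divided_power:
  "(divided_power j has_real_derivative divided_power (j - 1) u) (at u)"
proof (cases "j \<le> 0")
  case True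
  then have "divided_power j = (\<lambda>u. if j < 0 then 0 else 1)"
    by (auto simp: divided_power_def fun_eq_iff)
  with True show ?thesis by simp
next
  case False
  then obtain i where i: "j = int (Suc i)"
    by (metis not_le zero_less_imp_eq_int gr0_implies_Suc)
  have "((\<lambda>u. u ^ Suc i / fact (Suc i)) has_real_derivative
          of_nat (Suc i) * u ^ i / fact (Suc i)) (at u)"
    using DERIV_cdivide[OF DERIV_pow[of "Suc i" u], of "fact (Suc i)"] by simp
  moreover have "of_nat (Suc i) * u ^ i / fact (Suc i) = u ^ i / (fact i :: real)"
    by (simp del: of_nat_Suc)
  moreover have "divided_power j = (\<lambda>u. u ^ Suc i / fact (Suc i))"
    using i by (simp add: divided_power_def fun_eq_iff nat_add_distrib)
  moreover have "divided_power (j - 1) u = u ^ i / fact i"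
    using i by (simp add: divided_power_def)
  ultimately show ?thesis by (simp only:)
qed

text \<open>
  The coefficients of an everywhere convergent expansion are unique, so the description of \<open>Y\<close>
  picks out the coefficients found by expanding the exponential. When an index is negative, or
  \<open>n < k\<close>, one of the two divided powers has a negative index and both sides vanish.
\<close>

lemma Y_eq_divided_powers:
  "Y k n x a b m =
     fact (nat n) / (b - a) powi m * (divided_power k (x - a) * divided_power (n - k) (b - x))"
proof (cases "k < 0 \<or> n < 0")
  case True
  then have "k < 0 \<or> n - k < 0" by linarith
  with True show ?thesis by (auto simp: Y_def)
next
  case False
  let ?c = "\<lambda>j. if j < nat k then 0
       else fact j * (x - a) ^ nat k * (b - x) ^ (j - nat k)
              / ((b - a) powi m * fact (nat k) * fact (j - nat k))"
  have "(THE c :: nat \<Rightarrow> real. \<forall>t :: complex.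
          (\<lambda>j. of_real (c j) * (t ^ j / fact j)) sums f_Y (nat k) x t a b m) = ?c"
    by (rule the1_equality[OF Y_unique_expansion]) (intro allI f_Y_expansion)
  with False have "Y k n x a b m = ?c (nat n)"
    by (simp add: Y_def)
  with False show ?thesis
    by (auto simp: divided_power_def nat_diff_distrib mult_ac)
qed

theorem corollary1:
  fixes a b x :: real and m k n :: int
  assumes "0 \<le> a" and "0 \<le> b" and "a \<noteq> b"
    and "0 < m"
    and "x \<in> {a..b}"
    and "0 \<le> k" and "0 \<le> n" and "k \<le> n"
  shows "((\<lambda>x. Y k n x a b m) has_real_derivative
            of_int n * ((Y (k - 1) (n - 1) x a b (m - 1) - Y k (n - 1) x a b (m - 1)) / (b - a)))
         (at x)"
proof -
  let ?D = "divided_power (k - 1) (x - a) * divided_power (n - k) (b - x)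
          - divided_power k (x - a) * divided_power (n - 1 - k) (b - x)"
  have l: "((\<lambda>x. divided_power k (x - a)) has_real_derivative divided_power (k - 1) (x - a)) (at x)"
    by (rule DERIV_cong[OF DERIV_chain2[OF has_real_derivative_divided_power]])
      (auto intro!: derivative_eq_intros)
  have r: "((\<lambda>x. divided_power (n - k) (b - x)) has_real_derivative
          - divided_power (n - 1 - k) (b - x)) (at x)"
    by (rule DERIV_cong[OF DERIV_chain2[OF has_real_derivative_divided_power, where Db = "-1"]])
      (auto intro!: derivative_eq_intros simp: algebra_simps)
  have "((\<lambda>x. Y k n x a b m) has_real_derivative
          fact (nat n) / (b - a) powi m * ?D) (at x)"
    unfolding Y_eq_divided_powers
    by (intro DERIV_cmult DERIV_cong[OF DERIV_mult[OF l r]]) (simp add: mult.commute)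
  moreover have "fact (nat n) / (b - a) powi m * ?D
      = of_int n * ((Y (k - 1) (n - 1) x a b (m - 1) - Y k (n - 1) x a b (m - 1)) / (b - a))"
  proof (cases "n = 0")
    case True
    \<comment> \<open>Here \<open>n! = n (n - 1)!\<close> is not available, but \<open>k = 0\<close> and both products vanish.\<close>
    with assms have "k = 0" by simp
    with True show ?thesis by simp
  next
    case False
    with assms have "nat n = Suc (nat (n - 1))" by linarith
    then have "fact (nat n) = of_int n * (fact (nat (n - 1)) :: real)"
      using assms by (simp add: of_nat_nat)
    moreover have "(b - a) powi m = (b - a) * (b - a) powi (m - 1)"
      using assms power_int_add_1'[of "b - a" "m - 1"] by simp
    ultimately show ?thesis
      by (simp add: Y_eq_divided_powers right_diff_distrib diff_divide_distrib mult_ac)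
  qed
  ultimately show ?thesis by simp
qed

end
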